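(* Let $\mathcal X,\mathcal Y$ be nonempty convex $\mathcal K$-representable sets, and let a continuous convex-concave function $\psi:\mathcal X\times\mathcal Y\to\mathbb R$ admit an essentially strictly feasible $\mathcal K$-representation $$\psi(x,y)=\inf_{f,t,u}\{f^Ty+t: Pf+tp+Qu+Rx\leq_{\mathbf K}s\}\quad\forall x\in\mathcal X,\ y\in\mathcal Y\qquad[\mathbf K\in\mathcal K].$$ Then the convex-concave function $\overline\psi(y,x):=-\psi(x,y)$ on $\mathcal Y\times\mathcal X$ ($y$ being the "convex" and $x$ the "concave" argument) is $\mathcal K$-representable, with the $\mathcal K$-representation $$\overline\psi(y,x)=\inf_{\overline f,\overline t,\overline u}\left\{\overline f^{\,T}x+\overline t:\ \begin{array}{l}\overline f=-R^T\overline u,\ \overline t=s^T\overline u,\ Q^T\overline u=0,\\ p^T\overline u+1=0,\ P^T\overline u+y=0,\ \overline u\in\mathbf K^*\end{array}\right\}\quad\forall y\in\mathcal Y,\ x\in\mathcal X.$$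
   Context: $\mathcal K$ is a fixed family of regular cones (closed, convex, pointed, with nonempty interior) in Euclidean spaces which contains $\mathbb R_+$, is closed under finite direct products, and is closed under passing from a cone $\mathbf K$ to its dual $\mathbf K^*$. $a\leq_{\mathbf K}b$ means $b-a\in\mathbf K$. A set $X$ is $\mathcal K$-representable if $X=\{x:\exists u:Ax+Bu\leq_{\mathbf K}c\}$ for some $A,B,c$ and $\mathbf K\in\mathcal K$. Finite systems of $\mathcal K$-conic constraints $A_kx\leq_{\mathbf K_k}a_k$ ($\mathbf K_k\in\mathcal K$), linear equalities and nonstrict linear inequalities are again (equivalent to) a single $\mathcal K$-conic constraint. A conic constraint $Ax\leq_{\mathbf K}a$ is essentially strictly feasible if $\mathbf K=\mathbb R^m_+\times\mathbf L$ with regular $\mathbf L$ (either factor may be absent), so that it reads $Px\leq p$, $Qx\leq_{\mathbf L}q$, and there is $\bar x$ with $P\bar x\leq p$ and $q-Q\bar x\in\operatorname{int}\mathbf L$. A continuous convex-concave (convex in the first, concave in the second argument) function $\psi:\mathcal X\times\mathcal Y\to\mathbb R$ is $\mathcal K$-representable on $\mathcal X\times\mathcal Y$ if $\psi(x,y)=\inf_{f,t,u}\{f^Ty+t:Pf+tp+Qu+Rx\leq_{\mathbf K}s\}$ for all $x\in\mathcal X,y\in\mathcal Y$, with some $\mathbf K\in\mathcal K$ and data $P,p,Q,R,s$ (the constraint may be given as an equivalent finite system). This representation is essentially strictly feasible if for every $x\in\mathcal X$ the conic constraint $Pf+tp+Qu\leq_{\mathbf K}s-Rx$ in variables $f,t,u$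 is essentially strictly feasible. *)

theory Defs
  imports "HOL-Analysis.Analysis" "Jordan_Normal_Form.Matrix"
begin

hide_type (open) Finite_Cartesian_Product.vec
unbundle no inner_syntax

(* A Euclidean space of dimension n is taken in orthonormal coordinates, as carrier_vec n
   with the standard scalar product. The case n = 0 is allowed throughout. *)

section \<open>Topology and convexity\<close>

definition vec_distance :: "nat \<Rightarrow> real vec \<Rightarrow> real vec \<Rightarrow> real" where
  "vec_distance n x y = L2_set (\<lambda>i. x $ i - y $ i) {..<n}"

lemma Metric_space_vec: "Metric_space (carrier_vec n) (vec_distance n)"
proof
  fix x y z :: "real vec"
  show "0 \<le> vec_distance n x y"
    by (simp add: vec_distance_def L2_set_nonneg)
  show "vec_distance n x y = vec_distance n y x"
    by (simp add: vec_distance_def L2_set_def power2_commute)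
  show "vec_distance n x y = 0 \<longleftrightarrow> x = y" if "x \<in> carrier_vec n" "y \<in> carrier_vec n"
    using that by (auto simp: vec_distance_def L2_set_eq_0_iff)
  show "vec_distance n x z \<le> vec_distance n x y + vec_distance n y z"
    using L2_set_triangle_ineq[of "\<lambda>i. x $ i - y $ i" "\<lambda>i. y $ i - z $ i" "{..<n}"]
    by (simp add: vec_distance_def)
qed

definition vec_topology :: "nat \<Rightarrow> real vec topology" where
  "vec_topology n = Metric_space.mtopology (carrier_vec n) (vec_distance n)"

definition vec_convex :: "real vec set \<Rightarrow> bool" where
  "vec_convex X \<longleftrightarrow>
     (\<forall>x\<in>X. \<forall>y\<in>X. \<forall>a\<ge>0. \<forall>b\<ge>0. a + b = 1 \<longrightarrow> a \<cdot>\<^sub>v x + b \<cdot>\<^sub>v y \<in> X)"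

definition vec_convex_on :: "real vec set \<Rightarrow> (real vec \<Rightarrow> real) \<Rightarrow> bool" where
  "vec_convex_on X g \<longleftrightarrow>
     (\<forall>x\<in>X. \<forall>y\<in>X. \<forall>a\<ge>0. \<forall>b\<ge>0. a + b = 1 \<longrightarrow>
        g (a \<cdot>\<^sub>v x + b \<cdot>\<^sub>v y) \<le> a * g x + b * g y)"

definition vec_concave_on :: "real vec set \<Rightarrow> (real vec \<Rightarrow> real) \<Rightarrow> bool" where
  "vec_concave_on X g \<longleftrightarrow> vec_convex_on X (\<lambda>x. - g x)"

definition continuous_convex_concave ::
    "nat \<Rightarrow> nat \<Rightarrow> real vec set \<Rightarrow> real vec set \<Rightarrow> (real vec \<Rightarrow> real vec \<Rightarrow> real) \<Rightarrow> bool" where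
  "continuous_convex_concave nx ny X Y \<psi> \<longleftrightarrow>
     continuous_map
       (prod_topology (subtopology (vec_topology nx) X) (subtopology (vec_topology ny) Y))
       euclideanreal (\<lambda>(x, y). \<psi> x y) \<and>
     (\<forall>y\<in>Y. vec_convex_on X (\<lambda>x. \<psi> x y)) \<and>
     (\<forall>x\<in>X. vec_concave_on Y (\<lambda>y. \<psi> x y))"

section \<open>Cones and conic constraints\<close>

(* For n = 0 the cone carrier_vec 0 is regular. *)
definition regular_cone :: "nat \<Rightarrow> real vec set \<Rightarrow> bool" where
  "regular_cone n C \<longleftrightarrow>
     C \<subseteq> carrier_vec n \<and>
     (\<forall>x\<in>C. \<forall>a\<ge>0. a \<cdot>\<^sub>v x \<in> C) \<and> vec_convex C \<and>
     closedin (vec_topology n) C \<and>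
     (\<forall>x\<in>C. - x \<in> C \<longrightarrow> x = 0\<^sub>v n) \<and>
     vec_topology n interior_of C \<noteq> {}"

definition nonneg_orthant :: "nat \<Rightarrow> real vec set" where
  "nonneg_orthant n = {x \<in> carrier_vec n. 0\<^sub>v n \<le> x}"

definition cone_product :: "real vec set \<Rightarrow> real vec set \<Rightarrow> real vec set" where
  "cone_product C D = {x @\<^sub>v y | x y. x \<in> C \<and> y \<in> D}"

definition dual_cone :: "nat \<Rightarrow> real vec set \<Rightarrow> real vec set" where
  "dual_cone n C = {y \<in> carrier_vec n. \<forall>x\<in>C. 0 \<le> x \<bullet> y}"

(* The members of the family that lie in dimension n form the set \<K> n. *)
definition cone_family :: "(nat \<Rightarrow> real vec set set) \<Rightarrow> bool" where
  "cone_family \<K> \<longleftrightarrow>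
     (\<forall>n. \<forall>C\<in>\<K> n. regular_cone n C) \<and>
     nonneg_orthant 1 \<in> \<K> 1 \<and>
     (\<forall>m n. \<forall>C\<in>\<K> m. \<forall>D\<in>\<K> n. cone_product C D \<in> \<K> (m + n)) \<and>
     (\<forall>n. \<forall>C\<in>\<K> n. dual_cone n C \<in> \<K> n)"

definition cone_le :: "real vec set \<Rightarrow> real vec \<Rightarrow> real vec \<Rightarrow> bool" where
  "cone_le C a b \<longleftrightarrow> b - a \<in> C"

definition representable_set :: "(nat \<Rightarrow> real vec set set) \<Rightarrow> nat \<Rightarrow> real vec set \<Rightarrow> bool" where
  "representable_set \<K> n X \<longleftrightarrow>
     (\<exists>m k C A B c. C \<in> \<K> m \<and> A \<in> carrier_mat m n \<and> B \<in> carrier_mat m k \<and> c \<in> carrier_vec m \<and>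
        X = {x \<in> carrier_vec n. \<exists>u\<in>carrier_vec k. cone_le C (A *\<^sub>v x + B *\<^sub>v u) c})"

(* The constraint A x <= a with respect to the cone C in dimension m, the variable x having
   dimension n. The choices l = 0 and k = 0 are the cases in which L, respectively the
   orthant, is absent. *)
definition essentially_strictly_feasible ::
    "nat \<Rightarrow> nat \<Rightarrow> real vec set \<Rightarrow> real mat \<Rightarrow> real vec \<Rightarrow> bool" where
  "essentially_strictly_feasible m n C A a \<longleftrightarrow>
     (\<exists>k l L. m = k + l \<and> regular_cone l L \<and> C = cone_product (nonneg_orthant k) L \<and>
        (\<exists>x\<in>carrier_vec n. \<exists>r\<in>nonneg_orthant k. \<exists>q\<in>vec_topology l interior_of L.
           a - A *\<^sub>v x = r @\<^sub>v q))"

section \<open>Representable convex-concave functions\<close>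

(* S f t u x is a constraint, possibly given as a finite system, which is equivalent to
   a single conic constraint over the family. *)
definition conic_constraint ::
    "(nat \<Rightarrow> real vec set set) \<Rightarrow> nat \<Rightarrow> nat \<Rightarrow> nat \<Rightarrow>
     (real vec \<Rightarrow> real \<Rightarrow> real vec \<Rightarrow> real vec \<Rightarrow> bool) \<Rightarrow> bool" where
  "conic_constraint \<K> nf nu nx S \<longleftrightarrow>
     (\<exists>m C P p Q R s. C \<in> \<K> m \<and>
        P \<in> carrier_mat m nf \<and> p \<in> carrier_vec m \<and> Q \<in> carrier_mat m nu \<and>
        R \<in> carrier_mat m nx \<and> s \<in> carrier_vec m \<and>
        (\<forall>f\<in>carrier_vec nf. \<forall>t. \<forall>u\<in>carrier_vec nu. \<forall>x\<in>carrier_vec nx.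
           S f t u x \<longleftrightarrow> cone_le C (P *\<^sub>v f + t \<cdot>\<^sub>v p + Q *\<^sub>v u + R *\<^sub>v x) s))"

(* The infimum is taken in the extended reals; in particular the formula forces it
   to be finite on X and Y. *)
definition is_representation ::
    "(nat \<Rightarrow> real vec set set) \<Rightarrow> nat \<Rightarrow> nat \<Rightarrow> nat \<Rightarrow> real vec set \<Rightarrow> real vec set \<Rightarrow>
     (real vec \<Rightarrow> real \<Rightarrow> real vec \<Rightarrow> real vec \<Rightarrow> bool) \<Rightarrow>
     (real vec \<Rightarrow> real vec \<Rightarrow> real) \<Rightarrow> bool" where
  "is_representation \<K> nx ny nu X Y S \<psi> \<longleftrightarrow>
     conic_constraint \<K> ny nu nx S \<and>
     (\<forall>x\<in>X. \<forall>y\<in>Y.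
        ereal (\<psi> x y) =
        Inf {ereal (f \<bullet> y + t) | f t u.
               f \<in> carrier_vec ny \<and> u \<in> carrier_vec nu \<and> S f t u x})"

definition representable_function ::
    "(nat \<Rightarrow> real vec set set) \<Rightarrow> nat \<Rightarrow> nat \<Rightarrow> real vec set \<Rightarrow> real vec set \<Rightarrow>
     (real vec \<Rightarrow> real vec \<Rightarrow> real) \<Rightarrow> bool" where
  "representable_function \<K> nx ny X Y \<psi> \<longleftrightarrow>
     continuous_convex_concave nx ny X Y \<psi> \<and>
     (\<exists>nu S. is_representation \<K> nx ny nu X Y S \<psi>)"

(* The block matrix [P, p, Q] acting on the stacked variable (f, t, u). *)
definition block_matrix :: "nat \<Rightarrow> real mat \<Rightarrow> real vec \<Rightarrow> real mat \<Rightarrow> real mat" where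
  "block_matrix m P p Q = mat_of_cols m (cols P @ p # cols Q)"

lemma block_matrix_mult:
  assumes P: "P \<in> carrier_mat m nf" and p: "p \<in> carrier_vec m" and Q: "Q \<in> carrier_mat m nu"
    and f: "f \<in> carrier_vec nf" and u: "u \<in> carrier_vec nu"
  shows "block_matrix m P p Q *\<^sub>v (f @\<^sub>v vec 1 (\<lambda>_. t) @\<^sub>v u) = P *\<^sub>v f + t \<cdot>\<^sub>v p + Q *\<^sub>v u"
proof (rule eq_vecI)
  fix i assume "i < dim_vec (P *\<^sub>v f + t \<cdot>\<^sub>v p + Q *\<^sub>v u)"
  then have i: "i < m" using Q by simp
  have split: "(\<Sum>j<nf + Suc nu. g j) = (\<Sum>j<nf. g j) + g nf + (\<Sum>j<nu. g (Suc (nf + j)))"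
    for g :: "nat \<Rightarrow> real"
    by (induction nu) auto
  have row: "row (block_matrix m P p Q) i =
      vec (nf + Suc nu) (\<lambda>j. ((cols P @ p # cols Q) ! j) $ i)"
    using i P Q by (auto simp: block_matrix_def mat_of_cols_def row_def)
  have "(block_matrix m P p Q *\<^sub>v (f @\<^sub>v vec 1 (\<lambda>_. t) @\<^sub>v u)) $ i =
      (\<Sum>j<nf + Suc nu. ((cols P @ p # cols Q) ! j) $ i * (f @\<^sub>v vec 1 (\<lambda>_. t) @\<^sub>v u) $ j)"
    using i f u row by (simp add: block_matrix_def scalar_prod_def lessThan_atLeast0)
  also have "\<dots> = (P *\<^sub>v f + t \<cdot>\<^sub>v p + Q *\<^sub>v u) $ i"
    unfolding split using i P p Q f u
    by (simp add: nth_append scalar_prod_def lessThan_atLeast0 flip: add_Suc_right)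
  finally show "(block_matrix m P p Q *\<^sub>v (f @\<^sub>v vec 1 (\<lambda>_. t) @\<^sub>v u)) $ i =
      (P *\<^sub>v f + t \<cdot>\<^sub>v p + Q *\<^sub>v u) $ i" .
qed (use Q in \<open>simp add: block_matrix_def\<close>)

end

theory Submission
  imports Defs
begin

text \<open>
  For fixed $x$ and $y$ the infimum defining $\psi(x,y)$ is the value of a conic programme, and the
  claimed formula is minus the value of its dual. Weak duality is immediate. For strong duality,
  homogenise the programme and treat the two blocks of constraints separately: the M. Riesz extension
  theorem yields the multiplier of the block with a strictly feasible point, an interior point being
  an order unit, and once that block has been absorbed into the objective the Farkas lemma yields the
  multipliers of the linear inequalities, which needs no strict feasibility. Both arguments are
  algebraic, so the finite dimension enters only through an induction on the coordinates.
\<close>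

section \<open>Farkas lemma and M. Riesz extension\<close>

text \<open>The given point is strict only for the cone \<open>L\<close>. It may satisfy linear
  inequalities with equality, so it need not be interior to the product cone and cannot act as an
  order unit for both blocks at once. A Farkas argument on both blocks fails too, because a linear
  image of a non-polyhedral closed cone need not be closed. This forces the split and its order: the
  linear inequalities stay as constraints on the variable while the multiplier of \<open>L\<close>
  is built, and what remains is polyhedral. The multipliers solve the dual exactly, so the dual
  infimum is attained and needs no limit. The delicate point of homogenisation is the vectors whose
  homogenising coordinate is 0. The bound on the primal values does not speak about them, and the
  feasible point is used a second time to perturb them. In the claimed formula the first two
  components are functions of the third, which turns its objective into
  \<open>(s - R *\<^sub>v x) \<bullet> u\<close>, the dual objective for fixed
  \<open>x\<close>.\<close>

lemma farkas_vec:
  fixes a :: "nat \<Rightarrow> real vec" and c :: "real vec"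
  assumes "\<And>i. i < k \<Longrightarrow> a i \<in> carrier_vec n" and "c \<in> carrier_vec n"
    and "\<And>z. z \<in> carrier_vec n \<Longrightarrow> (\<And>i. i < k \<Longrightarrow> a i \<bullet> z \<le> 0) \<Longrightarrow> c \<bullet> z \<le> 0"
  shows "\<exists>\<mu>. (\<forall>i<k. 0 \<le> \<mu> i) \<and> (\<forall>z\<in>carrier_vec n. c \<bullet> z = (\<Sum>i<k. \<mu> i * (a i \<bullet> z)))"
  using assms
proof (induction k arbitrary: a c)
  case 0
  have "c \<bullet> z = 0" if z: "z \<in> carrier_vec n" for z
  proof -
    have "c \<bullet> (- z) = - (c \<bullet> z)" using z 0(2) by simp
    then show ?thesis using 0(3)[of z] 0(3)[of "- z"] z by simp
  qed
  then show ?case by simp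
next
  case (Suc k)
  note a = Suc.prems(1) and c = Suc.prems(2)
  show ?case
  proof (cases "\<forall>z\<in>carrier_vec n. (\<forall>i<k. a i \<bullet> z \<le> 0) \<longrightarrow> c \<bullet> z \<le> 0")
    case True
    then obtain \<mu> where "\<forall>i<k. 0 \<le> \<mu> i"
      "\<forall>z\<in>carrier_vec n. c \<bullet> z = (\<Sum>i<k. \<mu> i * (a i \<bullet> z))"
      using Suc.IH[of a c] a c by auto
    then show ?thesis by (intro exI[of _ "\<mu>(k := 0)"]) auto
  next
    case False
    then obtain y where y: "y \<in> carrier_vec n" and ay: "\<And>i. i < k \<Longrightarrow> a i \<bullet> y \<le> 0" and cy: "0 < c \<bullet> y"
      by force
    have aky: "0 < a k \<bullet> y"
      using Suc.prems(3)[OF y] ay cy by (metis less_Suc_eq not_le)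
    define x where "x = (1 / (a k \<bullet> y)) \<cdot>\<^sub>v y"
    have x: "x \<in> carrier_vec n" and akx: "a k \<bullet> x = 1" and cx: "0 < c \<bullet> x"
      and ax: "\<And>i. i < k \<Longrightarrow> a i \<bullet> x \<le> 0"
      using y a c aky cy ay by (auto simp: x_def divide_nonpos_pos)
    \<comment> \<open>Project along x onto the kernel of the last functional.\<close>
    define a' where "a' i = a i - (a i \<bullet> x) \<cdot>\<^sub>v a k" for i
    define c' where "c' = c - (c \<bullet> x) \<cdot>\<^sub>v a k"
    have a': "a' i \<in> carrier_vec n" if "i < k" for i using a that by (auto simp: a'_def)
    have c': "c' \<in> carrier_vec n" using a c by (auto simp: c'_def)
    have a'z: "a' i \<bullet> z = a i \<bullet> z - (a i \<bullet> x) * (a k \<bullet> z)" if "i < k" "z \<in> carrier_vec n" for i z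
      using that a by (simp add: a'_def minus_scalar_prod_distrib[of _ n])
    have c'z: "c' \<bullet> z = c \<bullet> z - (c \<bullet> x) * (a k \<bullet> z)" if "z \<in> carrier_vec n" for z
      using that a c by (simp add: c'_def minus_scalar_prod_distrib[of _ n])
    have "c' \<bullet> z \<le> 0" if z: "z \<in> carrier_vec n" and az: "\<And>i. i < k \<Longrightarrow> a' i \<bullet> z \<le> 0" for z
    proof -
      \<comment> \<open>The projected point satisfies \<open>a k \<bullet> z' = 0\<close> and
        \<open>a i \<bullet> z' = a' i \<bullet> z\<close>, so it obeys all \<open>Suc k\<close>
        inequalities; moreover \<open>c \<bullet> z' = c' \<bullet> z\<close>.\<close>
      define z' where "z' = z - (a k \<bullet> z) \<cdot>\<^sub>v x"
      have z': "z' \<in> carrier_vec n" using z x by (simp add: z'_def)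
      have d: "d \<bullet> z' = d \<bullet> z - (a k \<bullet> z) * (d \<bullet> x)" if "d \<in> carrier_vec n" for d
        using that z x by (simp add: z'_def scalar_prod_minus_distrib[of _ n])
      have "a i \<bullet> z' \<le> 0" if "i < Suc k" for i
      proof (cases "i = k")
        case True
        then show ?thesis using d[of "a k"] a akx by simp
      next
        case False
        then have "i < k" using that by simp
        then show ?thesis using d[of "a i"] a az[of i] a'z[of i z] z by (simp add: mult.commute)
      qed
      then have "c \<bullet> z' \<le> 0" using Suc.prems(3) z' by blast
      then show ?thesis using d[OF c] c'z[OF z] by (simp add: mult.commute)
    qed
    then obtain \<mu> where \<mu>: "\<forall>i<k. 0 \<le> \<mu> i"
      and eq: "\<forall>z\<in>carrier_vec n. c' \<bullet> z = (\<Sum>i<k. \<mu> i * (a' i \<bullet> z))"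
      using Suc.IH[of a' c'] a' c' by auto
    \<comment> \<open>The coefficient that \<open>a k\<close> receives when the identity for
      \<open>c'\<close> is expanded. Its sign is right because \<open>x\<close> was chosen with
      \<open>c \<bullet> x\<close> positive and the other \<open>a i \<bullet> x\<close>
      nonpositive.\<close>
    define m where "m = c \<bullet> x - (\<Sum>i<k. \<mu> i * (a i \<bullet> x))"
    have "(\<Sum>i<k. \<mu> i * (a i \<bullet> x)) \<le> 0"
      using \<mu> ax by (intro sum_nonpos) (auto intro: mult_nonneg_nonpos)
    then have m: "0 \<le> m" using cx by (simp add: m_def)
    have "c \<bullet> z = (\<Sum>i<k. \<mu> i * (a i \<bullet> z)) + m * (a k \<bullet> z)" if z: "z \<in> carrier_vec n" for z
    proof -
      have "c \<bullet> z - (c \<bullet> x) * (a k \<bullet> z) = (\<Sum>i<k. \<mu> i * (a i \<bullet> z - (a i \<bullet> x) * (a k \<bullet> z)))"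
        using eq z c'z[OF z] a'z[OF _ z] by simp
      also have "\<dots> = (\<Sum>i<k. \<mu> i * (a i \<bullet> z)) - (\<Sum>i<k. \<mu> i * (a i \<bullet> x)) * (a k \<bullet> z)"
        by (simp add: algebra_simps sum_subtractf sum_distrib_left)
      finally show ?thesis by (simp add: m_def algebra_simps)
    qed
    then show ?thesis using \<mu> m by (intro exI[of _ "\<mu>(k := m)"]) (auto simp: less_Suc_eq)
  qed
qed

lemma real_sets_separated:
  fixes S T :: "real set"
  assumes "S \<noteq> {}" "T \<noteq> {}" and le: "\<And>s t. s \<in> S \<Longrightarrow> t \<in> T \<Longrightarrow> s \<le> t"
  obtains c where "\<And>s. s \<in> S \<Longrightarrow> s \<le> c" "\<And>t. t \<in> T \<Longrightarrow> c \<le> t"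
proof
  obtain t0 where "t0 \<in> T" using assms by blast
  then have "bdd_above S" using le by (intro bdd_aboveI[of S t0])
  then show "s \<le> Sup S" if "s \<in> S" for s using that by (rule cSup_upper[rotated])
  show "Sup S \<le> t" if "t \<in> T" for t using that le assms(1) by (intro cSup_least) auto
qed

text \<open>\<open>G\<close> is a convex cone on which the functional taking (0, \<tau>) to \<tau>
  is nonnegative wherever it is defined; it is extended by one coordinate at a time. The assumption
  \<open>total\<close> provides elements with either sign of the new coordinate, so the new
  coefficient is bounded on both sides.\<close>

lemma riesz_extension_vec:
  fixes G :: "(real vec \<times> real) set"
  assumes carrier: "\<And>w \<tau>. (w, \<tau>) \<in> G \<Longrightarrow> w \<in> carrier_vec l"
    and add: "\<And>w \<tau> w' \<tau>'. (w, \<tau>) \<in> G \<Longrightarrow> (w', \<tau>') \<in> G \<Longrightarrow> (w + w', \<tau> + \<tau>') \<in> G"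
    and scale: "\<And>w \<tau> r. (w, \<tau>) \<in> G \<Longrightarrow> 0 < r \<Longrightarrow> (r \<cdot>\<^sub>v w, r * \<tau>) \<in> G"
    and zero: "\<And>\<tau>. (0\<^sub>v l, \<tau>) \<in> G \<Longrightarrow> 0 \<le> \<tau>"
    and total: "\<And>w. w \<in> carrier_vec l \<Longrightarrow> \<exists>\<tau>. (w, \<tau>) \<in> G"
  obtains \<nu> where "\<nu> \<in> carrier_vec l" "\<And>w \<tau>. (w, \<tau>) \<in> G \<Longrightarrow> 0 \<le> \<nu> \<bullet> w + \<tau>"
proof -
  \<comment> \<open>At stage \<open>j\<close> only elements whose \<open>w\<close> vanishes from
    coordinate \<open>j\<close> on are controlled; at \<open>j = l\<close> this restriction is
    void.\<close>
  have "\<exists>\<nu>::nat \<Rightarrow> real. \<forall>w \<tau>. (w, \<tau>) \<in> G \<longrightarrow> (\<forall>i<l. j \<le> i \<longrightarrow> w $ i = 0) \<longrightarrow>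
      0 \<le> (\<Sum>i<j. \<nu> i * w $ i) + \<tau>" if "j \<le> l" for j
    using that
  proof (induction j)
    case 0
    have "0 \<le> \<tau>" if "(w, \<tau>) \<in> G" "\<forall>i<l. w $ i = 0" for w \<tau>
    proof -
      have "w = 0\<^sub>v l" using that carrier[OF that(1)] by auto
      then show ?thesis using zero that by simp
    qed
    then show ?case by auto
  next
    case (Suc j)
    then obtain \<nu> where \<nu>: "\<And>w \<tau>. (w, \<tau>) \<in> G \<Longrightarrow> \<forall>i<l. j \<le> i \<longrightarrow> w $ i = 0 \<Longrightarrow>
        0 \<le> (\<Sum>i<j. \<nu> i * w $ i) + \<tau>" by auto
    define g where "g w \<tau> = (\<Sum>i<j. \<nu> i * w $ i) + \<tau>" for w :: "real vec" and \<tau>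
    define H where "H = {(w, \<tau>). (w, \<tau>) \<in> G \<and> (\<forall>i<l. Suc j \<le> i \<longrightarrow> w $ i = 0)}"
    \<comment> \<open>Solving \<open>0 \<le> g w \<tau> + c * w $ j\<close> for the new coefficient
      \<open>c\<close>: elements with \<open>w $ j > 0\<close> give the lower bounds
      \<open>S\<close>, those with \<open>w $ j < 0\<close> the upper bounds
      \<open>T\<close>.\<close>
    define S where "S = {- g w \<tau> / w $ j | w \<tau>. (w, \<tau>) \<in> H \<and> 0 < w $ j}"
    define T where "T = {- g w \<tau> / w $ j | w \<tau>. (w, \<tau>) \<in> H \<and> w $ j < 0}"
    have jl: "j < l" using Suc by simp
    have ex: "\<exists>\<tau>. (r \<cdot>\<^sub>v unit_vec l j, \<tau>) \<in> H" for r
      using total[of "r \<cdot>\<^sub>v unit_vec l j"] jl by (auto simp: H_def)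
    have S: "S \<noteq> {}" using ex[of 1] jl by (fastforce simp: S_def)
    have T: "T \<noteq> {}" using ex[of "-1"] jl by (fastforce simp: T_def)
    have "s \<le> t" if s: "s \<in> S" and t: "t \<in> T" for s t
    proof -
      obtain w \<tau> where w: "(w, \<tau>) \<in> H" "0 < w $ j" and s_eq: "s = - g w \<tau> / w $ j"
        using s by (auto simp: S_def)
      obtain w' \<tau>' where w': "(w', \<tau>') \<in> H" "w' $ j < 0" and t_eq: "t = - g w' \<tau>' / w' $ j"
        using t by (auto simp: T_def)
      have cw: "w \<in> carrier_vec l" "w' \<in> carrier_vec l" using w w' carrier by (auto simp: H_def)
      \<comment> \<open>The positive weights are chosen to cancel coordinate \<open>j\<close>, which
        brings the combination under the induction hypothesis.\<close>
      let ?w = "(- w' $ j) \<cdot>\<^sub>v w + w $ j \<cdot>\<^sub>v w'"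
      let ?t = "(- w' $ j) * \<tau> + w $ j * \<tau>'"
      have "(?w, ?t) \<in> G" using w w' by (intro add scale) (auto simp: H_def)
      moreover have "\<forall>i<l. j \<le> i \<longrightarrow> ?w $ i = 0"
        using w w' cw by (auto simp: H_def le_eq_less_or_eq[of j] Suc_le_eq)
      ultimately have "0 \<le> g ?w ?t" using \<nu> by (simp add: g_def)
      also have "g ?w ?t = (- w' $ j) * g w \<tau> + w $ j * g w' \<tau>'"
        using cw jl by (simp add: g_def algebra_simps sum.distrib sum_distrib_left sum_negf sum_subtractf)
      finally show ?thesis using w(2) w'(2) unfolding s_eq t_eq
        by (simp add: field_simps)
    qed
    then obtain c where lo: "\<And>s. s \<in> S \<Longrightarrow> s \<le> c" and up: "\<And>t. t \<in> T \<Longrightarrow> c \<le> t"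
      using real_sets_separated[OF S T] by metis
    have "0 \<le> (\<Sum>i<Suc j. (\<nu>(j := c)) i * w $ i) + \<tau>"
      if "(w, \<tau>) \<in> G" "\<forall>i<l. Suc j \<le> i \<longrightarrow> w $ i = 0" for w \<tau>
    proof -
      have H: "(w, \<tau>) \<in> H" using that by (simp add: H_def)
      have "0 \<le> g w \<tau> + c * w $ j"
      proof (cases "w $ j" "0 :: real" rule: linorder_cases)
        case less
        then have "c \<le> - g w \<tau> / w $ j" using H by (intro up) (auto simp: T_def)
        then show ?thesis using less by (simp add: field_simps)
      next
        case equal
        then have "\<forall>i<l. j \<le> i \<longrightarrow> w $ i = 0"
          using that(2) by (auto simp: le_eq_less_or_eq Suc_le_eq)
        then show ?thesis using \<nu>[OF that(1)] equal by (simp add: g_def)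
      next
        case greater
        then have "- g w \<tau> / w $ j \<le> c" using H by (intro lo) (auto simp: S_def)
        then show ?thesis using greater by (simp add: field_simps)
      qed
      then show ?thesis by (simp add: g_def algebra_simps)
    qed
    then show ?case by blast
  qed
  from this[OF order_refl] obtain \<nu> where \<nu>:
    "\<And>w \<tau>. (w, \<tau>) \<in> G \<Longrightarrow> 0 \<le> (\<Sum>i<l. \<nu> i * w $ i) + \<tau>" by auto
  show thesis
  proof
    show "vec l \<nu> \<in> carrier_vec l" by simp
    show "0 \<le> vec l \<nu> \<bullet> w + \<tau>" if "(w, \<tau>) \<in> G" for w \<tau>
      using \<nu>[OF that] carrier[OF that] by (simp add: scalar_prod_def lessThan_atLeast0)
  qed
qed

section \<open>Order units and the homogeneous conic Farkas lemma\<close>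

lemma interior_is_order_unit:
  assumes w: "w \<in> vec_topology l interior_of L" and v: "v \<in> carrier_vec l"
    and scale: "\<And>x r. x \<in> L \<Longrightarrow> 0 \<le> r \<Longrightarrow> r \<cdot>\<^sub>v x \<in> L"
  obtains t where "0 < t" "t \<cdot>\<^sub>v w + v \<in> L"
proof -
  interpret Metric_space "carrier_vec l" "vec_distance l" by (rule Metric_space_vec)
  obtain e where wc: "w \<in> carrier_vec l" and e: "0 < e" "mball w e \<subseteq> L"
    using w by (auto simp: vec_topology_def metric_interior_of)
  define N where "N = L2_set (\<lambda>i. v $ i) {..<l}"
  have N: "0 \<le> N" by (simp add: N_def L2_set_nonneg)
  \<comment> \<open>The \<open>+ 1\<close> keeps the quotient defined for \<open>v = 0\<close> and
    makes \<open>d * N < e\<close> strict.\<close>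
  define d where "d = e / (N + 1)"
  have d: "0 < d" using e N by (simp add: d_def)
  have "vec_distance l w (w + d \<cdot>\<^sub>v v) = L2_set (\<lambda>i. d * v $ i) {..<l}"
    using wc v by (simp add: vec_distance_def L2_set_def)
  also have "\<dots> = d * N" using d by (simp add: N_def L2_set_right_distrib)
  also have "\<dots> < e" using e N by (simp add: d_def field_simps)
  finally have "w + d \<cdot>\<^sub>v v \<in> L" using e wc v by (auto simp: in_mball)
  then have "(1 / d) \<cdot>\<^sub>v (w + d \<cdot>\<^sub>v v) \<in> L" using d by (intro scale) auto
  also have "(1 / d) \<cdot>\<^sub>v (w + d \<cdot>\<^sub>v v) = (1 / d) \<cdot>\<^sub>v w + v"
    using wc v d by (auto simp: field_simps)
  finally show thesis using d that[of "1 / d"] by simp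
qed

text \<open>Because the linear inequalities are part of the definition of the epigraph, the
  multiplier \<open>\<nu>\<close> satisfies
  \<open>\<nu> \<bullet> (B *\<^sub>v z) \<le> c \<bullet> z\<close> for every \<open>z\<close>
  obeying them, whether or not \<open>B *\<^sub>v z\<close> lies in \<open>L\<close>. That is a
  purely polyhedral implication, from which \<open>\<mu>\<close> is read off.\<close>

lemma conic_farkas:
  fixes a :: "nat \<Rightarrow> real vec" and B :: "real mat"
  assumes a: "\<And>i. i < k \<Longrightarrow> a i \<in> carrier_vec n" and B: "B \<in> carrier_mat l n"
    and c: "c \<in> carrier_vec n"
    and L: "L \<subseteq> carrier_vec l" "0\<^sub>v l \<in> L"
    and L_add: "\<And>x y. x \<in> L \<Longrightarrow> y \<in> L \<Longrightarrow> x + y \<in> L"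
    and L_scale: "\<And>x r. x \<in> L \<Longrightarrow> 0 \<le> r \<Longrightarrow> r \<cdot>\<^sub>v x \<in> L"
    and z0: "z0 \<in> carrier_vec n" "\<And>i. i < k \<Longrightarrow> a i \<bullet> z0 \<le> 0"
    and unit: "\<And>w. w \<in> carrier_vec l \<Longrightarrow> \<exists>t>0. t \<cdot>\<^sub>v (B *\<^sub>v z0) + w \<in> L"
    and nonneg: "\<And>z. z \<in> carrier_vec n \<Longrightarrow> (\<And>i. i < k \<Longrightarrow> a i \<bullet> z \<le> 0) \<Longrightarrow> B *\<^sub>v z \<in> L \<Longrightarrow> 0 \<le> c \<bullet> z"
  obtains \<mu> \<nu> where "\<And>i. i < k \<Longrightarrow> 0 \<le> \<mu> i" "\<nu> \<in> carrier_vec l" "\<And>w. w \<in> L \<Longrightarrow> 0 \<le> \<nu> \<bullet> w"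
    "\<And>z. z \<in> carrier_vec n \<Longrightarrow> c \<bullet> z + (\<Sum>i<k. \<mu> i * (a i \<bullet> z)) = \<nu> \<bullet> (B *\<^sub>v z)"
proof -
  \<comment> \<open>The epigraph of the value function of the perturbed homogeneous problem; a minorant of the
    value function is an extension of $(0, \tau) \mapsto \tau$ that is nonnegative on it.\<close>
  define G where "G = {(w, \<tau>). w \<in> carrier_vec l \<and>
    (\<exists>z\<in>carrier_vec n. (\<forall>i<k. a i \<bullet> z \<le> 0) \<and> w + B *\<^sub>v z \<in> L \<and> c \<bullet> z \<le> \<tau>)}"
  obtain \<nu> where \<nu>: "\<nu> \<in> carrier_vec l" and pos: "\<And>w \<tau>. (w, \<tau>) \<in> G \<Longrightarrow> 0 \<le> \<nu> \<bullet> w + \<tau>"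
  proof (rule riesz_extension_vec[of G l])
    show "w \<in> carrier_vec l" if "(w, \<tau>) \<in> G" for w \<tau> using that by (simp add: G_def)
    show "(w + w', \<tau> + \<tau>') \<in> G" if g: "(w, \<tau>) \<in> G" "(w', \<tau>') \<in> G" for w \<tau> w' \<tau>'
    proof -
      obtain z z' where z: "z \<in> carrier_vec n" "\<forall>i<k. a i \<bullet> z \<le> 0" "w + B *\<^sub>v z \<in> L" "c \<bullet> z \<le> \<tau>"
        and z': "z' \<in> carrier_vec n" "\<forall>i<k. a i \<bullet> z' \<le> 0" "w' + B *\<^sub>v z' \<in> L" "c \<bullet> z' \<le> \<tau>'"
        and w: "w \<in> carrier_vec l" "w' \<in> carrier_vec l"
        using g by (auto simp: G_def)
      have "w + w' + B *\<^sub>v (z + z') = (w + B *\<^sub>v z) + (w' + B *\<^sub>v z')"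
        using w z z' B by (auto simp: mult_add_distrib_mat_vec[of _ l n])
      then have "w + w' + B *\<^sub>v (z + z') \<in> L" using L_add z z' by simp
      moreover have "a i \<bullet> (z + z') \<le> 0" if "i < k" for i
        using z z' a[OF that] that by (simp add: scalar_prod_add_distrib[of _ n] add_nonpos_nonpos)
      moreover have "c \<bullet> (z + z') \<le> \<tau> + \<tau>'"
        using z z' c by (simp add: scalar_prod_add_distrib[of _ n])
      ultimately show ?thesis using w z z' by (auto simp: G_def intro!: bexI[of _ "z + z'"])
    qed
    show "(r \<cdot>\<^sub>v w, r * \<tau>) \<in> G" if g: "(w, \<tau>) \<in> G" and r: "0 < r" for w \<tau> r
    proof -
      obtain z where z: "z \<in> carrier_vec n" "\<forall>i<k. a i \<bullet> z \<le> 0" "w + B *\<^sub>v z \<in> L" "c \<bullet> z \<le> \<tau>"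
        and w: "w \<in> carrier_vec l"
        using g by (auto simp: G_def)
      have "r \<cdot>\<^sub>v w + B *\<^sub>v (r \<cdot>\<^sub>v z) = r \<cdot>\<^sub>v (w + B *\<^sub>v z)"
        using w z B by (auto simp: mult_mat_vec[of _ l n] algebra_simps)
      then have "r \<cdot>\<^sub>v w + B *\<^sub>v (r \<cdot>\<^sub>v z) \<in> L" using L_scale z r by simp
      moreover have "a i \<bullet> (r \<cdot>\<^sub>v z) \<le> 0" if "i < k" for i
        using z a[OF that] that r by (simp add: mult_nonneg_nonpos)
      moreover have "c \<bullet> (r \<cdot>\<^sub>v z) \<le> r * \<tau>"
        using z c r by simp
      ultimately show ?thesis using w z by (auto simp: G_def intro!: bexI[of _ "r \<cdot>\<^sub>v z"])
    qed
    show "0 \<le> \<tau>" if h: "(0\<^sub>v l, \<tau>) \<in> G" for \<tau>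
    proof -
      obtain z where z: "z \<in> carrier_vec n" "\<forall>i<k. a i \<bullet> z \<le> 0" "0\<^sub>v l + B *\<^sub>v z \<in> L" "c \<bullet> z \<le> \<tau>"
        using h by (auto simp: G_def)
      moreover have "0\<^sub>v l + B *\<^sub>v z = B *\<^sub>v z" using B z by (intro left_zero_vec) auto
      ultimately have "0 \<le> c \<bullet> z" by (intro nonneg) auto
      then show ?thesis using z by simp
    qed
    \<comment> \<open>A large multiple of \<open>z0\<close> absorbs any perturbation
      \<open>w\<close>, so the perturbed problem is always feasible and its cost serves as
      \<tau>.\<close>
    show "\<exists>\<tau>. (w, \<tau>) \<in> G" if w: "w \<in> carrier_vec l" for w
    proof -
      obtain t where t: "0 < t" "t \<cdot>\<^sub>v (B *\<^sub>v z0) + w \<in> L" using unit[OF w] by blast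
      have "w + B *\<^sub>v (t \<cdot>\<^sub>v z0) = t \<cdot>\<^sub>v (B *\<^sub>v z0) + w"
        using w z0 B by (auto simp: mult_mat_vec[of _ l n])
      then have "w + B *\<^sub>v (t \<cdot>\<^sub>v z0) \<in> L" using t by simp
      moreover have "a i \<bullet> (t \<cdot>\<^sub>v z0) \<le> 0" if "i < k" for i
        using z0 a[OF that] that t by (simp add: mult_nonneg_nonpos)
      ultimately show ?thesis using w z0 by (auto simp: G_def intro!: bexI[of _ "t \<cdot>\<^sub>v z0"])
    qed
  qed (rule that)
  \<comment> \<open>For \<open>w\<close> in \<open>L\<close> the choice \<open>z = 0\<close> is
    admissible at cost 0.\<close>
  have \<nu>L: "0 \<le> \<nu> \<bullet> w" if w: "w \<in> L" for w
  proof -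
    have "w + B *\<^sub>v 0\<^sub>v n = w" using subsetD[OF L(1) w] B by auto
    then have "(w, 0) \<in> G"
      using w L a c by (auto simp: G_def intro!: bexI[of _ "0\<^sub>v n"])
    then show ?thesis using pos by fastforce
  qed
  define d where "d = transpose_mat B *\<^sub>v \<nu> - c"
  have d: "d \<in> carrier_vec n" using B c \<nu> by (auto simp: d_def)
  have dz: "d \<bullet> z = \<nu> \<bullet> (B *\<^sub>v z) - c \<bullet> z" if z: "z \<in> carrier_vec n" for z
    using B c \<nu> z by (simp add: d_def minus_scalar_prod_distrib[of _ n] transpose_vec_mult_scalar[of _ l n])
  \<comment> \<open>The perturbation \<open>- (B *\<^sub>v z)\<close> makes the conic constraint
    read \<open>0 \<in> L\<close>, so every \<open>z\<close> obeying the linear inequalities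
    contributes to \<open>G\<close>.\<close>
  have "d \<bullet> z \<le> 0" if z: "z \<in> carrier_vec n" and az: "\<And>i. i < k \<Longrightarrow> a i \<bullet> z \<le> 0" for z
  proof -
    have Bz: "B *\<^sub>v z \<in> carrier_vec l" using B z by auto
    then have "- (B *\<^sub>v z) + B *\<^sub>v z \<in> L" using L(2) by (simp add: uminus_l_inv_vec[of _ l])
    then have "(- (B *\<^sub>v z), c \<bullet> z) \<in> G" using Bz z az by (auto simp: G_def intro!: bexI[of _ z])
    moreover have "\<nu> \<bullet> (- (B *\<^sub>v z)) = - (\<nu> \<bullet> (B *\<^sub>v z))" using \<nu> B by simp
    ultimately show ?thesis using pos dz[OF z] by fastforce
  qed
  then obtain \<mu> where \<mu>: "\<forall>i<k. 0 \<le> \<mu> i" "\<forall>z\<in>carrier_vec n. d \<bullet> z = (\<Sum>i<k. \<mu> i * (a i \<bullet> z))"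
    using farkas_vec[of k a n d] a d by auto
  show thesis
  proof (rule that[of \<mu> \<nu>])
    show "c \<bullet> z + (\<Sum>i<k. \<mu> i * (a i \<bullet> z)) = \<nu> \<bullet> (B *\<^sub>v z)" if "z \<in> carrier_vec n" for z
      using \<mu>(2) dz[OF that] that by simp
  qed (use \<mu> \<nu> \<nu>L in auto)
qed

section \<open>Conic duality\<close>

lemma regular_cone_zero:
  assumes "regular_cone n C" shows "0\<^sub>v n \<in> C"
proof -
  obtain x where x: "x \<in> C" using assms interior_of_subset[of "vec_topology n" C]
    by (auto simp: regular_cone_def)
  then have "0 \<cdot>\<^sub>v x \<in> C" using assms by (auto simp: regular_cone_def)
  moreover have "x \<in> carrier_vec n" using x assms by (auto simp: regular_cone_def)
  then have "0 \<cdot>\<^sub>v x = 0\<^sub>v n" by auto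
  ultimately show ?thesis by simp
qed

lemma regular_cone_add:
  assumes C: "regular_cone n C" and x: "x \<in> C" and y: "y \<in> C" shows "x + y \<in> C"
proof -
  have "(1/2) \<cdot>\<^sub>v x + (1/2) \<cdot>\<^sub>v y \<in> C" using assms by (auto simp: regular_cone_def vec_convex_def)
  then have "2 \<cdot>\<^sub>v ((1/2) \<cdot>\<^sub>v x + (1/2) \<cdot>\<^sub>v y) \<in> C" using C by (auto simp: regular_cone_def)
  moreover have "x \<in> carrier_vec n" "y \<in> carrier_vec n" using assms by (auto simp: regular_cone_def)
  then have "2 \<cdot>\<^sub>v ((1/2) \<cdot>\<^sub>v x + (1/2) \<cdot>\<^sub>v y) = x + y" by auto
  ultimately show ?thesis by simp
qed

lemma nonneg_orthant_iff: "x \<in> nonneg_orthant n \<longleftrightarrow> x \<in> carrier_vec n \<and> (\<forall>i<n. 0 \<le> x $ i)"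
  by (auto simp: nonneg_orthant_def less_eq_vec_def)

text \<open>The homogeneous lemma is applied to pairs (\<alpha>, z). Its nonnegativity hypothesis
  follows from \<open>bound\<close> by rescaling when \<alpha> is positive, and by a limit
  otherwise. The dual optimality conditions are kept as an identity in \<open>z\<close>, ready to be
  tested on blocks of variables.\<close>

lemma conic_duality:
  assumes M: "M \<in> carrier_mat (k + l) n" and b: "b \<in> carrier_vec (k + l)" and c: "c \<in> carrier_vec n"
    and L: "regular_cone l L"
    and z0: "z0 \<in> carrier_vec n" and r: "r \<in> nonneg_orthant k" and q: "q \<in> vec_topology l interior_of L"
    and slater: "b - M *\<^sub>v z0 = r @\<^sub>v q"
    and bound: "\<And>z. z \<in> carrier_vec n \<Longrightarrow> b - M *\<^sub>v z \<in> cone_product (nonneg_orthant k) L \<Longrightarrow> v \<le> c \<bullet> z"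
  obtains y where "y \<in> dual_cone (k + l) (cone_product (nonneg_orthant k) L)"
    "\<And>z. z \<in> carrier_vec n \<Longrightarrow> c \<bullet> z + y \<bullet> (M *\<^sub>v z) = 0" "v \<le> - (b \<bullet> y)"
proof -
  have Lc: "L \<subseteq> carrier_vec l" using L by (simp add: regular_cone_def)
  have L_scale: "s \<cdot>\<^sub>v x \<in> L" if "x \<in> L" "0 \<le> s" for x s
    using L that by (auto simp: regular_cone_def)
  have rc: "r \<in> carrier_vec k" using r by (simp add: nonneg_orthant_iff)
  have r_nonneg: "0 \<le> r $ i" if "i < k" for i using r that by (simp add: nonneg_orthant_iff)
  have qL: "q \<in> L" using q by (rule subsetD[OF interior_of_subset])
  then have qc: "q \<in> carrier_vec l" using Lc by auto
  \<comment> \<open>Homogenise: the first coordinate of the extended variable scales the right-hand side.\<close>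
  define a where "a i = (if i < k then vCons (- b $ i) (row M i) else vCons (-1) (0\<^sub>v n))" for i
  define B where "B = mat l (Suc n) (\<lambda>(i, j). if j = 0 then b $ (k + i) else - M $$ (k + i, j - 1))"
  \<comment> \<open>\<open>c' \<bullet> vCons \<alpha> z\<close> is
    \<open>c \<bullet> z - \<alpha> * v\<close>, so the lower bound \<open>v\<close> becomes
    nonnegativity of a linear functional. The extra functional with index \<open>k\<close> encodes
    \<open>0 \<le> \<alpha>\<close>.\<close>
  define c' where "c' = vCons (- v) c"
  have a: "a i \<in> carrier_vec (Suc n)" for i using M by (auto simp: a_def)
  have B: "B \<in> carrier_mat l (Suc n)" by (simp add: B_def)
  have c': "c' \<in> carrier_vec (Suc n)" using c by (simp add: c'_def)
  have az: "a i \<bullet> vCons \<alpha> z = - (\<alpha> * b $ i - (M *\<^sub>v z) $ i)" if "i < k" "z \<in> carrier_vec n" for i \<alpha> z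
    using that M by (simp add: a_def)
  have ak: "a k \<bullet> vCons \<alpha> z = - \<alpha>" if "z \<in> carrier_vec n" for \<alpha> z
    using that by (simp add: a_def)
  have Bz: "B *\<^sub>v vCons \<alpha> z = vec l (\<lambda>i. \<alpha> * b $ (k + i) - (M *\<^sub>v z) $ (k + i))"
    if z: "z \<in> carrier_vec n" for \<alpha> z
  proof (rule eq_vecI)
    fix i assume "i < dim_vec (vec l (\<lambda>i. \<alpha> * b $ (k + i) - (M *\<^sub>v z) $ (k + i)))"
    then have i: "i < l" by simp
    have "row B i = vCons (b $ (k + i)) (- row M (k + i))"
      using i M by (auto simp: B_def vec_index_vCons)
    then show "(B *\<^sub>v vCons \<alpha> z) $ i = vec l (\<lambda>i. \<alpha> * b $ (k + i) - (M *\<^sub>v z) $ (k + i)) $ i"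
      using i M B z by (simp add: mult.commute)
  qed (use B in simp)
  have split: "\<alpha> \<cdot>\<^sub>v b - M *\<^sub>v z = vec k (\<lambda>i. \<alpha> * b $ i - (M *\<^sub>v z) $ i) @\<^sub>v (B *\<^sub>v vCons \<alpha> z)"
    if "z \<in> carrier_vec n" for \<alpha> z
    unfolding Bz[OF that] using b M that by (intro eq_vecI) (auto simp: not_less)
  have z0': "vec k (\<lambda>i. b $ i - (M *\<^sub>v z0) $ i) = r" "B *\<^sub>v vCons 1 z0 = q"
  proof -
    have "vec k (\<lambda>i. b $ i - (M *\<^sub>v z0) $ i) @\<^sub>v (B *\<^sub>v vCons 1 z0) = r @\<^sub>v q"
      using split[OF z0, of 1] slater by simp
    then show "vec k (\<lambda>i. b $ i - (M *\<^sub>v z0) $ i) = r" "B *\<^sub>v vCons 1 z0 = q"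
      using rc by (auto simp: append_vec_eq[of _ k])
  qed
  have pos_scale: "\<alpha> * v \<le> c \<bullet> z"
    if z: "z \<in> carrier_vec n" and \<alpha>: "0 < \<alpha>" and h1: "\<And>i. i < k \<Longrightarrow> a i \<bullet> vCons \<alpha> z \<le> 0"
      and h2: "B *\<^sub>v vCons \<alpha> z \<in> L" for z \<alpha>
  proof -
    let ?z = "(1 / \<alpha>) \<cdot>\<^sub>v z"
    have Mz: "M *\<^sub>v ?z = (1 / \<alpha>) \<cdot>\<^sub>v (M *\<^sub>v z)" using M z by (simp add: mult_mat_vec[of _ "k + l" n])
    have "B *\<^sub>v vCons 1 ?z = (1 / \<alpha>) \<cdot>\<^sub>v (B *\<^sub>v vCons \<alpha> z)"
      using z \<alpha> M by (auto simp: Bz Mz field_simps)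
    then have "B *\<^sub>v vCons 1 ?z \<in> L" using L_scale h2 \<alpha> by simp
    moreover have "vec k (\<lambda>i. b $ i - (M *\<^sub>v ?z) $ i) \<in> nonneg_orthant k"
      using h1 \<alpha> z M by (auto simp: nonneg_orthant_iff az Mz field_simps)
    ultimately have "b - M *\<^sub>v ?z \<in> cone_product (nonneg_orthant k) L"
      using split[of ?z 1] z by (auto simp: cone_product_def)
    then have "v \<le> c \<bullet> ?z" using bound z by simp
    then show ?thesis using \<alpha> c z by (simp add: field_simps)
  qed
  obtain \<mu> \<nu> where \<mu>: "\<And>i. i < Suc k \<Longrightarrow> 0 \<le> \<mu> i" and \<nu>: "\<nu> \<in> carrier_vec l" "\<And>w. w \<in> L \<Longrightarrow> 0 \<le> \<nu> \<bullet> w"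
    and eq: "\<And>z. z \<in> carrier_vec (Suc n) \<Longrightarrow> c' \<bullet> z + (\<Sum>i<Suc k. \<mu> i * (a i \<bullet> z)) = \<nu> \<bullet> (B *\<^sub>v z)"
  proof (rule conic_farkas[of "Suc k" a "Suc n" B l c' L "vCons 1 z0"])
    show "a i \<bullet> vCons 1 z0 \<le> 0" if "i < Suc k" for i
    proof (cases "i = k")
      case False
      then have i: "i < k" using that by simp
      then have "r $ i = b $ i - (M *\<^sub>v z0) $ i" by (simp flip: z0'(1))
      moreover have "0 \<le> r $ i" using r_nonneg[OF i] .
      ultimately show ?thesis using az[OF i z0, of 1] by simp
    qed (use ak z0 in simp)
    show "\<exists>t>0. t \<cdot>\<^sub>v (B *\<^sub>v vCons 1 z0) + w \<in> L" if w: "w \<in> carrier_vec l" for w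
      by (rule interior_is_order_unit[OF q w L_scale]) (auto simp: z0')
    fix z' assume z': "z' \<in> carrier_vec (Suc n)" and h1: "\<And>i. i < Suc k \<Longrightarrow> a i \<bullet> z' \<le> 0"
      and h2: "B *\<^sub>v z' \<in> L"
    obtain \<alpha> z where z'_eq: "z' = vCons \<alpha> z" and z: "z \<in> carrier_vec n"
      using z' by (cases z') auto
    have \<alpha>: "0 \<le> \<alpha>" using h1[of k] ak[OF z] by (simp add: z'_eq)
    \<comment> \<open>For \<alpha> = 0 the vector \<open>z\<close> is only a recession direction and
      cannot be rescaled. Adding \<open>e\<close> times the feasible point \<open>vCons 1 z0\<close>
      makes the homogenising coordinate positive and keeps all constraints; then \<open>e\<close>
      tends to 0 from the right.\<close>
    have approx: "(\<alpha> + e) * v \<le> c \<bullet> z + e * (c \<bullet> z0)" if e: "0 < e" for e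
    proof -
      let ?z = "z + e \<cdot>\<^sub>v z0"
      have zc: "?z \<in> carrier_vec n" using z z0 by simp
      have Mz: "M *\<^sub>v ?z = M *\<^sub>v z + e \<cdot>\<^sub>v (M *\<^sub>v z0)"
        using M z z0 by (simp add: mult_add_distrib_mat_vec[of _ "k + l" n] mult_mat_vec[of _ "k + l" n])
      have "(\<alpha> + e) * v \<le> c \<bullet> ?z"
      proof (rule pos_scale[OF zc])
        show "0 < \<alpha> + e" using \<alpha> e by simp
        have "B *\<^sub>v vCons (\<alpha> + e) ?z = B *\<^sub>v vCons \<alpha> z + e \<cdot>\<^sub>v (B *\<^sub>v vCons 1 z0)"
          using M z z0 by (auto simp: Bz Mz algebra_simps)
        then show "B *\<^sub>v vCons (\<alpha> + e) ?z \<in> L"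
          using regular_cone_add[OF L] L_scale h2 qL e by (simp add: z0' z'_eq)
        fix i assume i: "i < k"
        have "r $ i = b $ i - (M *\<^sub>v z0) $ i" using i by (simp flip: z0'(1))
        moreover have "0 \<le> r $ i" using r_nonneg[OF i] .
        moreover have "0 \<le> \<alpha> * b $ i - (M *\<^sub>v z) $ i" using h1[of i] az[OF i z] i by (simp add: z'_eq)
        ultimately have "0 \<le> (\<alpha> * b $ i - (M *\<^sub>v z) $ i) + e * (b $ i - (M *\<^sub>v z0) $ i)"
          using e by simp
        then show "a i \<bullet> vCons (\<alpha> + e) ?z \<le> 0"
          using i M z z0 unfolding az[OF i zc] Mz by (simp add: algebra_simps)
      qed
      then show ?thesis using c z z0 by (simp add: scalar_prod_add_distrib[of _ n])
    qed
    have lim: "((\<lambda>e. c \<bullet> z + e * (c \<bullet> z0) - (\<alpha> + e) * v) \<longlongrightarrow> c \<bullet> z + 0 * (c \<bullet> z0) - (\<alpha> + 0) * v) (at_right 0)"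
      by (intro tendsto_intros)
    have "0 \<le> c \<bullet> z + 0 * (c \<bullet> z0) - (\<alpha> + 0) * v"
      by (rule tendsto_lowerbound[OF lim])
        (use approx in \<open>auto intro!: eventually_mono[OF eventually_at_right_less]\<close>)
    then show "0 \<le> c' \<bullet> z'" by (simp add: c'_def z'_eq mult.commute)
  next
    show "x + y \<in> L" if "x \<in> L" "y \<in> L" for x y using regular_cone_add[OF L that] .
    show "0\<^sub>v l \<in> L" using regular_cone_zero[OF L] .
    show "s \<cdot>\<^sub>v x \<in> L" if "x \<in> L" "0 \<le> s" for x s using L_scale[OF that] .
    show "vCons 1 z0 \<in> carrier_vec (Suc n)" using z0 by simp
    show "a i \<in> carrier_vec (Suc n)" for i by (rule a)
    show "B \<in> carrier_mat l (Suc n)" "c' \<in> carrier_vec (Suc n)" "L \<subseteq> carrier_vec l" by fact+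
  qed (rule that)
  define y where "y = vec k \<mu> @\<^sub>v \<nu>"
  have y: "y \<in> carrier_vec (k + l)" using \<nu> by (auto simp: y_def)
  have y_dual: "y \<in> dual_cone (k + l) (cone_product (nonneg_orthant k) L)"
  proof -
    have "0 \<le> (g @\<^sub>v h) \<bullet> y" if g: "g \<in> nonneg_orthant k" and h: "h \<in> L" for g h
    proof -
      have gc: "g \<in> carrier_vec k" "h \<in> carrier_vec l" using g h Lc by (auto simp: nonneg_orthant_iff)
      then have "(g @\<^sub>v h) \<bullet> y = g \<bullet> vec k \<mu> + \<nu> \<bullet> h"
        using \<nu> by (simp add: y_def scalar_prod_append[of _ k _ l] comm_scalar_prod[of h l])
      moreover have "0 \<le> g \<bullet> vec k \<mu>"
        using g \<mu> unfolding scalar_prod_def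
        by (intro sum_nonneg mult_nonneg_nonneg) (auto simp: nonneg_orthant_iff)
      ultimately show ?thesis using \<nu>(2)[OF h] by simp
    qed
    then show ?thesis using y by (auto simp: dual_cone_def cone_product_def)
  qed
  \<comment> \<open>The multiplier identity at \<open>vCons \<alpha> z\<close>, with the multiplier
    \<open>\<mu> k\<close> of \<open>0 \<le> \<alpha>\<close> kept apart. Setting \<alpha> = 0 gives
    stationarity. Setting \<alpha> = 1 and \<open>z = 0\<close> gives the bound, with
    \<open>\<mu> k\<close> as its slack.\<close>
  have key: "\<alpha> * v + \<mu> k * \<alpha> = c \<bullet> z - y \<bullet> (\<alpha> \<cdot>\<^sub>v b - M *\<^sub>v z)" if z: "z \<in> carrier_vec n" for \<alpha> z
  proof -
    have "y \<bullet> (\<alpha> \<cdot>\<^sub>v b - M *\<^sub>v z) = (\<Sum>i<k. \<mu> i * (\<alpha> * b $ i - (M *\<^sub>v z) $ i)) + \<nu> \<bullet> (B *\<^sub>v vCons \<alpha> z)"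
      unfolding split[OF z] y_def using \<nu> B z
      by (subst scalar_prod_append[of _ k _ l]) (auto simp: scalar_prod_def lessThan_atLeast0)
    moreover have "(\<Sum>i<k. \<mu> i * (a i \<bullet> vCons \<alpha> z)) = - (\<Sum>i<k. \<mu> i * (\<alpha> * b $ i - (M *\<^sub>v z) $ i))"
      using z by (simp add: az algebra_simps flip: sum_negf)
    ultimately show ?thesis
      using eq[of "vCons \<alpha> z"] z ak[OF z] by (simp add: c'_def algebra_simps)
  qed
  have stationary: "c \<bullet> z + y \<bullet> (M *\<^sub>v z) = 0" if z: "z \<in> carrier_vec n" for z
  proof -
    have "0 \<cdot>\<^sub>v b - M *\<^sub>v z = - (M *\<^sub>v z)" using b M by (intro eq_vecI) auto
    then show ?thesis using key[OF z, of 0] y M by simp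
  qed
  have bound_y: "v \<le> - (b \<bullet> y)"
  proof -
    have "1 \<cdot>\<^sub>v b - M *\<^sub>v 0\<^sub>v n = b" using b M by (intro eq_vecI) auto
    then have "v + \<mu> k = - (y \<bullet> b)" using key[of "0\<^sub>v n" 1] c by simp
    then show ?thesis using \<mu>[of k] comm_scalar_prod[OF y b] by simp
  qed
  show thesis using that[OF y_dual stationary bound_y] .
qed

section \<open>Strong and weak duality for a representation at fixed arguments\<close>

lemma vec_eq_zero_if_orthogonal:
  fixes v :: "real vec"
  assumes "v \<in> carrier_vec n" and "\<And>z. z \<in> carrier_vec n \<Longrightarrow> v \<bullet> z = 0"
  shows "v = 0\<^sub>v n"
proof (rule eq_vecI)
  show "v $ i = 0\<^sub>v n $ i" if "i < dim_vec (0\<^sub>v n)" for i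
    using assms(2)[of "unit_vec n i"] assms(1) that by simp
qed (use assms in simp)

text \<open>Conic duality for the stacked variable (f, t, u) with cost vector (y, 1, 0). Testing the
  stationarity identity with all but one component equal to zero yields the three equations for
  \<open>w\<close>, one for each of \<open>P\<close>, \<open>p\<close> and \<open>Q\<close>.\<close>

lemma representation_strong_duality:
  assumes P: "P \<in> carrier_mat m ny" and p: "p \<in> carrier_vec m" and Q: "Q \<in> carrier_mat m nu"
    and b: "b \<in> carrier_vec m" and y: "y \<in> carrier_vec ny"
    and feasible: "essentially_strictly_feasible m (ny + 1 + nu) K (block_matrix m P p Q) b"
    and bound: "\<And>f t u. f \<in> carrier_vec ny \<Longrightarrow> u \<in> carrier_vec nu \<Longrightarrow>
      b - (P *\<^sub>v f + t \<cdot>\<^sub>v p + Q *\<^sub>v u) \<in> K \<Longrightarrow> v \<le> f \<bullet> y + t"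
  obtains w where "w \<in> dual_cone m K" "transpose_mat Q *\<^sub>v w = 0\<^sub>v nu" "p \<bullet> w + 1 = 0"
    "transpose_mat P *\<^sub>v w + y = 0\<^sub>v ny" "b \<bullet> w \<le> - v"
proof -
  obtain k l L z0 r q where m: "m = k + l" and L: "regular_cone l L"
    and K: "K = cone_product (nonneg_orthant k) L"
    and z0: "z0 \<in> carrier_vec (ny + 1 + nu)" and r: "r \<in> nonneg_orthant k"
    and q: "q \<in> vec_topology l interior_of L" and slater: "b - block_matrix m P p Q *\<^sub>v z0 = r @\<^sub>v q"
    using feasible unfolding essentially_strictly_feasible_def by blast
  let ?M = "block_matrix m P p Q"
  let ?z = "\<lambda>f t u. f @\<^sub>v vec 1 (\<lambda>_. t) @\<^sub>v u"
  let ?c = "y @\<^sub>v vec 1 (\<lambda>_. 1) @\<^sub>v 0\<^sub>v nu"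
  have M: "?M \<in> carrier_mat m (ny + 1 + nu)" unfolding block_matrix_def using P Q by (intro carrier_matI) auto
  have c: "?c \<in> carrier_vec (ny + 1 + nu)" using y by (intro carrier_vecI) auto
  have z: "?z f t u \<in> carrier_vec (ny + 1 + nu)"
    if "f \<in> carrier_vec ny" "u \<in> carrier_vec nu" for f t u using that by (intro carrier_vecI) auto
  have cz: "?c \<bullet> ?z f t u = y \<bullet> f + t" if "f \<in> carrier_vec ny" "u \<in> carrier_vec nu" for f t u
  proof -
    have "?c \<bullet> ?z f t u = y \<bullet> f + (vec 1 (\<lambda>_. 1) @\<^sub>v 0\<^sub>v nu) \<bullet> (vec 1 (\<lambda>_. t) @\<^sub>v u)"
      using y that by (intro scalar_prod_append[of _ ny _ "1 + nu"]) (auto intro: carrier_vecI)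
    also have "(vec 1 (\<lambda>_. 1) @\<^sub>v 0\<^sub>v nu) \<bullet> (vec 1 (\<lambda>_. t) @\<^sub>v u) =
        vec 1 (\<lambda>_. 1) \<bullet> vec 1 (\<lambda>_. t) + 0\<^sub>v nu \<bullet> u"
      using that by (intro scalar_prod_append[of _ 1 _ nu]) auto
    also have "\<dots> = t" using that by (simp add: scalar_prod_def)
    finally show ?thesis by simp
  qed
  have stack: "\<exists>f\<in>carrier_vec ny. \<exists>t. \<exists>u\<in>carrier_vec nu. x = ?z f t u"
    if x: "x \<in> carrier_vec (ny + 1 + nu)" for x :: "real vec"
  proof -
    \<comment> \<open>Coordinate \<open>ny\<close> holds \<open>t\<close>, hence \<open>u\<close>
      starts at \<open>ny + 1\<close>.\<close>
    let ?x = "?z (vec ny (($) x)) (x $ ny) (vec nu (\<lambda>i. x $ (ny + 1 + i)))"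
    have "x = ?x"
    proof (rule eq_vecI)
      fix i assume "i < dim_vec ?x"
      then have "i < ny + 1 + nu" by simp
      then consider "i < ny" | "i = ny" | j where "i = ny + 1 + j" "j < nu"
        by (cases i ny rule: linorder_cases) (auto dest!: less_imp_Suc_add)
      then show "x $ i = ?x $ i" by cases auto
    qed (use x in simp)
    then show ?thesis by (intro bexI[of _ "vec ny (($) x)"] exI[of _ "x $ ny"]
          bexI[of _ "vec nu (\<lambda>i. x $ (ny + 1 + i))"]) auto
  qed
  obtain w where w: "w \<in> dual_cone m K" and wb: "v \<le> - (b \<bullet> w)"
    and zero: "\<And>x. x \<in> carrier_vec (ny + 1 + nu) \<Longrightarrow> ?c \<bullet> x + w \<bullet> (?M *\<^sub>v x) = 0"
  proof (rule conic_duality[of ?M k l "ny + 1 + nu" b ?c L z0 r q v])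
    show "v \<le> ?c \<bullet> x" if xc: "x \<in> carrier_vec (ny + 1 + nu)"
      and xK: "b - ?M *\<^sub>v x \<in> cone_product (nonneg_orthant k) L" for x
    proof -
      obtain f t u where f: "f \<in> carrier_vec ny" and u: "u \<in> carrier_vec nu" and x: "x = ?z f t u"
        using stack[OF xc] by blast
      have "b - (P *\<^sub>v f + t \<cdot>\<^sub>v p + Q *\<^sub>v u) \<in> K"
        using xK block_matrix_mult[OF P p Q f u] by (simp add: x K)
      then have "v \<le> f \<bullet> y + t" by (rule bound[OF f u])
      then show ?thesis using cz[OF f u] comm_scalar_prod[OF f y] by (simp add: x)
    qed
    show "?M \<in> carrier_mat (k + l) (ny + 1 + nu)" "b \<in> carrier_vec (k + l)" using M b m by auto
  qed (use that c L z0 r q slater in \<open>simp_all add: m K\<close>)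
  have wc: "w \<in> carrier_vec m" using w by (simp add: dual_cone_def)
  have eq: "y \<bullet> f + t + w \<bullet> (P *\<^sub>v f + t \<cdot>\<^sub>v p + Q *\<^sub>v u) = 0"
    if f: "f \<in> carrier_vec ny" and u: "u \<in> carrier_vec nu" for f t u
    using zero[OF z[OF f u], of t] cz[OF f u, of t] block_matrix_mult[OF P p Q f u, of t] by simp
  have "transpose_mat P *\<^sub>v w + y = 0\<^sub>v ny"
  proof (rule vec_eq_zero_if_orthogonal)
    fix f :: "real vec" assume f: "f \<in> carrier_vec ny"
    have "P *\<^sub>v f + 0 \<cdot>\<^sub>v p + Q *\<^sub>v 0\<^sub>v nu = P *\<^sub>v f" using P p Q f by (intro eq_vecI) auto
    then have "y \<bullet> f + w \<bullet> (P *\<^sub>v f) = 0" using eq[OF f, of "0\<^sub>v nu" 0] by simp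
    then show "(transpose_mat P *\<^sub>v w + y) \<bullet> f = 0"
      using P wc y f transpose_vec_mult_scalar[OF P f wc] by (simp add: add_scalar_prod_distrib[of _ ny])
  qed (use P y wc in auto)
  moreover have "transpose_mat Q *\<^sub>v w = 0\<^sub>v nu"
  proof (rule vec_eq_zero_if_orthogonal)
    fix u :: "real vec" assume u: "u \<in> carrier_vec nu"
    have "P *\<^sub>v 0\<^sub>v ny + 0 \<cdot>\<^sub>v p + Q *\<^sub>v u = Q *\<^sub>v u" using P p Q u by (intro eq_vecI) auto
    then have "w \<bullet> (Q *\<^sub>v u) = 0" using eq[OF _ u, of "0\<^sub>v ny" 0] y by simp
    then show "(transpose_mat Q *\<^sub>v w) \<bullet> u = 0" using transpose_vec_mult_scalar[OF Q u wc] by simp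
  qed (use Q wc in auto)
  moreover have "p \<bullet> w + 1 = 0"
  proof -
    have "P *\<^sub>v 0\<^sub>v ny + 1 \<cdot>\<^sub>v p + Q *\<^sub>v 0\<^sub>v nu = p" using P p Q by (intro eq_vecI) auto
    then show ?thesis using eq[of "0\<^sub>v ny" "0\<^sub>v nu" 1] y comm_scalar_prod[OF p wc] by simp
  qed
  ultimately show thesis using that[of w] w wb by auto
qed

text \<open>The primal slack lies in \<open>K\<close> and \<open>w\<close> in its dual, so their
  product is nonnegative; the equations for \<open>w\<close> turn that product into
  \<open>b \<bullet> w + f \<bullet> y + t\<close>.\<close>

lemma representation_weak_duality:
  assumes P: "P \<in> carrier_mat m ny" and p: "p \<in> carrier_vec m" and Q: "Q \<in> carrier_mat m nu"
    and b: "b \<in> carrier_vec m" and y: "y \<in> carrier_vec ny"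
    and f: "f \<in> carrier_vec ny" and u: "u \<in> carrier_vec nu"
    and primal: "b - (P *\<^sub>v f + t \<cdot>\<^sub>v p + Q *\<^sub>v u) \<in> K"
    and w: "w \<in> dual_cone m K" and Qw: "transpose_mat Q *\<^sub>v w = 0\<^sub>v nu" and pw: "p \<bullet> w + 1 = 0"
    and Pw: "transpose_mat P *\<^sub>v w + y = 0\<^sub>v ny"
  shows "- (b \<bullet> w) \<le> f \<bullet> y + t"
proof -
  have wc: "w \<in> carrier_vec m" using w by (simp add: dual_cone_def)
  have "0 \<le> (b - (P *\<^sub>v f + t \<cdot>\<^sub>v p + Q *\<^sub>v u)) \<bullet> w" using w primal by (simp add: dual_cone_def)
  also have "\<dots> = b \<bullet> w - ((P *\<^sub>v f) \<bullet> w + t * (p \<bullet> w) + (Q *\<^sub>v u) \<bullet> w)"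
    using P p Q b f u wc by (simp add: minus_scalar_prod_distrib[of _ m] add_scalar_prod_distrib[of _ m])
  also have "(Q *\<^sub>v u) \<bullet> w = 0"
    using transpose_vec_mult_scalar[OF Q u wc] comm_scalar_prod[of "Q *\<^sub>v u" m w] Q u wc Qw by simp
  also have "(P *\<^sub>v f) \<bullet> w = - (f \<bullet> y)"
  proof -
    have "(transpose_mat P *\<^sub>v w + y) \<bullet> f = 0" using Pw f by simp
    then have "(transpose_mat P *\<^sub>v w) \<bullet> f + y \<bullet> f = 0"
      using P wc y f by (simp add: add_scalar_prod_distrib[of _ ny])
    then show ?thesis
      using transpose_vec_mult_scalar[OF P f wc] comm_scalar_prod[of "P *\<^sub>v f" m w] comm_scalar_prod[OF f y]
        P f wc by simp
  qed
  also have "p \<bullet> w = -1" using pw by simp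
  finally show ?thesis by simp
qed

section \<open>Conic constraints\<close>

text \<open>The splitting of a concatenation is unique once the length \<open>m\<close> of the first
  part is fixed, which is why \<open>C\<close> must lie in \<open>carrier_vec m\<close>.\<close>

lemma append_mem_cone_product:
  assumes "C \<subseteq> carrier_vec m" "a \<in> carrier_vec m"
  shows "a @\<^sub>v b \<in> cone_product C D \<longleftrightarrow> a \<in> C \<and> b \<in> D"
  using assms unfolding cone_product_def by (auto simp: append_vec_eq[of _ m] subset_iff)

lemma conic_constraint_cong:
  assumes "conic_constraint \<K> nf nu nx S"
    and "\<And>f t u x. f \<in> carrier_vec nf \<Longrightarrow> u \<in> carrier_vec nu \<Longrightarrow> x \<in> carrier_vec nx \<Longrightarrow>
      S' f t u x \<longleftrightarrow> S f t u x"
  shows "conic_constraint \<K> nf nu nx S'"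
  using assms unfolding conic_constraint_def by simp

text \<open>Stacking the data row-wise stacks the slacks, and the product cone tests the two slacks
  separately; closure of the family under products enters here.\<close>

lemma conic_constraint_conj:
  assumes \<K>: "cone_family \<K>" and S: "conic_constraint \<K> nf nu nx S" and T: "conic_constraint \<K> nf nu nx T"
  shows "conic_constraint \<K> nf nu nx (\<lambda>f t u x. S f t u x \<and> T f t u x)"
proof -
  obtain m C P p Q R s where C: "C \<in> \<K> m" and 1: "P \<in> carrier_mat m nf" "p \<in> carrier_vec m"
      "Q \<in> carrier_mat m nu" "R \<in> carrier_mat m nx" "s \<in> carrier_vec m"
    and S: "\<forall>f\<in>carrier_vec nf. \<forall>t. \<forall>u\<in>carrier_vec nu. \<forall>x\<in>carrier_vec nx.
      S f t u x \<longleftrightarrow> cone_le C (P *\<^sub>v f + t \<cdot>\<^sub>v p + Q *\<^sub>v u + R *\<^sub>v x) s"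
    using S unfolding conic_constraint_def by blast
  obtain m' C' P' p' Q' R' s' where C': "C' \<in> \<K> m'" and 2: "P' \<in> carrier_mat m' nf" "p' \<in> carrier_vec m'"
      "Q' \<in> carrier_mat m' nu" "R' \<in> carrier_mat m' nx" "s' \<in> carrier_vec m'"
    and T: "\<forall>f\<in>carrier_vec nf. \<forall>t. \<forall>u\<in>carrier_vec nu. \<forall>x\<in>carrier_vec nx.
      T f t u x \<longleftrightarrow> cone_le C' (P' *\<^sub>v f + t \<cdot>\<^sub>v p' + Q' *\<^sub>v u + R' *\<^sub>v x) s'"
    using T unfolding conic_constraint_def by blast
  have Cc: "C \<subseteq> carrier_vec m" using \<K> C by (auto simp: cone_family_def regular_cone_def)
  have "cone_product C C' \<in> \<K> (m + m')" using \<K> C C' by (auto simp: cone_family_def)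
  moreover have "(S f t u x \<and> T f t u x) \<longleftrightarrow> cone_le (cone_product C C')
      ((P @\<^sub>r P') *\<^sub>v f + t \<cdot>\<^sub>v (p @\<^sub>v p') + (Q @\<^sub>r Q') *\<^sub>v u + (R @\<^sub>r R') *\<^sub>v x) (s @\<^sub>v s')"
    if c: "f \<in> carrier_vec nf" "u \<in> carrier_vec nu" "x \<in> carrier_vec nx" for f t u x
  proof -
    have "(s @\<^sub>v s') - ((P @\<^sub>r P') *\<^sub>v f + t \<cdot>\<^sub>v (p @\<^sub>v p') + (Q @\<^sub>r Q') *\<^sub>v u + (R @\<^sub>r R') *\<^sub>v x) =
      (s - (P *\<^sub>v f + t \<cdot>\<^sub>v p + Q *\<^sub>v u + R *\<^sub>v x)) @\<^sub>v (s' - (P' *\<^sub>v f + t \<cdot>\<^sub>v p' + Q' *\<^sub>v u + R' *\<^sub>v x))"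
      unfolding mat_mult_append[OF 1(1) 2(1) c(1)] mat_mult_append[OF 1(3) 2(3) c(2)]
        mat_mult_append[OF 1(4) 2(4) c(3)]
      using 1 2 c by (intro eq_vecI) auto
    moreover have "s - (P *\<^sub>v f + t \<cdot>\<^sub>v p + Q *\<^sub>v u + R *\<^sub>v x) \<in> carrier_vec m" using 1 c by auto
    ultimately show ?thesis
      using S T c append_mem_cone_product[OF Cc] by (simp add: cone_le_def)
  qed
  ultimately show ?thesis
    unfolding conic_constraint_def using 1 2
    by (intro exI[of _ "m + m'"] exI[of _ "cone_product C C'"] exI[of _ "P @\<^sub>r P'"] exI[of _ "p @\<^sub>v p'"]
        exI[of _ "Q @\<^sub>r Q'"] exI[of _ "R @\<^sub>r R'"] exI[of _ "s @\<^sub>v s'"]) auto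
qed

lemma conic_constraint_le:
  assumes \<K>: "cone_family \<K>" and c: "a \<in> carrier_vec nf" "b \<in> carrier_vec nu" "c \<in> carrier_vec nx"
  shows "conic_constraint \<K> nf nu nx (\<lambda>f t u x. a \<bullet> f + r * t + b \<bullet> u + c \<bullet> x \<le> d)"
proof -
  have eta: "vec (dim_vec v) (($) v) = v" for v :: "real vec" by auto
  have "nonneg_orthant 1 \<in> \<K> 1" using \<K> by (simp add: cone_family_def)
  moreover have "a \<bullet> f + r * t + b \<bullet> u + c \<bullet> x \<le> d \<longleftrightarrow> cone_le (nonneg_orthant 1)
      (mat_of_row a *\<^sub>v f + t \<cdot>\<^sub>v vec 1 (\<lambda>_. r) + mat_of_row b *\<^sub>v u + mat_of_row c *\<^sub>v x) (vec 1 (\<lambda>_. d))"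
    for f t u x
    by (auto simp: cone_le_def nonneg_orthant_def less_eq_vec_def mat_of_row_def eta mult.commute intro!: carrier_vecI)
  ultimately show ?thesis
    unfolding conic_constraint_def using c
    by (intro exI[of _ 1] exI[of _ "nonneg_orthant 1"] exI[of _ "mat_of_row a"] exI[of _ "vec 1 (\<lambda>_. r)"]
        exI[of _ "mat_of_row b"] exI[of _ "mat_of_row c"] exI[of _ "vec 1 (\<lambda>_. d)"]) auto
qed

text \<open>The cone {0} has empty interior in positive dimension and so is not regular; an equation
  therefore enters as two opposite inequalities.\<close>

lemma conic_constraint_eq:
  assumes \<K>: "cone_family \<K>" and c: "a \<in> carrier_vec nf" "b \<in> carrier_vec nu" "c \<in> carrier_vec nx"
  shows "conic_constraint \<K> nf nu nx (\<lambda>f t u x. a \<bullet> f + r * t + b \<bullet> u + c \<bullet> x = d)"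
proof (rule conic_constraint_cong)
  show "conic_constraint \<K> nf nu nx (\<lambda>f t u x. a \<bullet> f + r * t + b \<bullet> u + c \<bullet> x \<le> d \<and>
      - a \<bullet> f + - r * t + - b \<bullet> u + - c \<bullet> x \<le> - d)"
    using c by (intro conic_constraint_conj conic_constraint_le \<K>) auto
qed (use c in auto)

lemma conic_constraint_all:
  fixes N :: nat
  assumes \<K>: "cone_family \<K>" and S: "\<And>i. i < N \<Longrightarrow> conic_constraint \<K> nf nu nx (S i)"
  shows "conic_constraint \<K> nf nu nx (\<lambda>f t u x. \<forall>i<N. S i f t u x)"
  using S
proof (induction N)
  case 0
  \<comment> \<open>The empty conjunction must still be given by a cone of the family; the
    constraint \<open>0 \<le> 0\<close> over the half-line serves.\<close>
  show ?case
    by (rule conic_constraint_cong[OF conic_constraint_le[OF \<K>, of "0\<^sub>v nf" _ "0\<^sub>v nu" _ "0\<^sub>v nx" _ 0 0]]) auto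
next
  case (Suc N)
  then have "conic_constraint \<K> nf nu nx (\<lambda>f t u x. (\<forall>i<N. S i f t u x) \<and> S N f t u x)"
    by (intro conic_constraint_conj \<K>) auto
  then show ?case by (rule conic_constraint_cong) (auto simp: less_Suc_eq)
qed

lemma conic_constraint_vec_eq:
  assumes \<K>: "cone_family \<K>" and A: "A \<in> carrier_mat N nf" and B: "B \<in> carrier_mat N nu"
    and D: "D \<in> carrier_mat N nx" and e: "e \<in> carrier_vec N"
  shows "conic_constraint \<K> nf nu nx (\<lambda>f t u x. A *\<^sub>v f + B *\<^sub>v u + D *\<^sub>v x = e)"
proof (rule conic_constraint_cong)
  show "conic_constraint \<K> nf nu nx
      (\<lambda>f t u x. \<forall>i<N. row A i \<bullet> f + 0 * t + row B i \<bullet> u + row D i \<bullet> x = e $ i)"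
    using A B D by (intro conic_constraint_all conic_constraint_eq \<K>) auto
qed (use A B D e in \<open>auto simp: vec_eq_iff\<close>)

lemma conic_constraint_mem:
  assumes \<K>: "cone_family \<K>" and C: "C \<in> \<K> nu"
  shows "conic_constraint \<K> nf nu nx (\<lambda>f t u x. u \<in> C)"
proof -
  have "u \<in> C \<longleftrightarrow> cone_le C (0\<^sub>m nu nf *\<^sub>v f + t \<cdot>\<^sub>v 0\<^sub>v nu + (- 1\<^sub>m nu) *\<^sub>v u + 0\<^sub>m nu nx *\<^sub>v x) (0\<^sub>v nu)"
    if "f \<in> carrier_vec nf" "u \<in> carrier_vec nu" "x \<in> carrier_vec nx" for f t u x
  proof -
    have "0\<^sub>v nu - (0\<^sub>m nu nf *\<^sub>v f + t \<cdot>\<^sub>v 0\<^sub>v nu + (- 1\<^sub>m nu) *\<^sub>v u + 0\<^sub>m nu nx *\<^sub>v x) = u"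
      using that by (intro eq_vecI) auto
    then show ?thesis by (simp add: cone_le_def)
  qed
  then show ?thesis
    unfolding conic_constraint_def using C
    by (intro exI[of _ nu] exI[of _ C] exI[of _ "0\<^sub>m nu nf"] exI[of _ "0\<^sub>v nu"]
        exI[of _ "- 1\<^sub>m nu"] exI[of _ "0\<^sub>m nu nx"]) auto
qed

text \<open>The roles of the dimensions change: \<open>f\<close> now has dimension
  \<open>nx\<close>, the auxiliary variable is a multiplier of dimension \<open>m\<close>, and
  \<open>y\<close> is the parameter. Closure of the family under duals admits the last
  clause.\<close>

lemma conic_constraint_dual_system:
  assumes \<K>: "cone_family \<K>" and K: "K \<in> \<K> m"
    and P: "P \<in> carrier_mat m ny" and p: "p \<in> carrier_vec m" and Q: "Q \<in> carrier_mat m nu"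
    and R: "R \<in> carrier_mat m nx" and s: "s \<in> carrier_vec m"
  shows "conic_constraint \<K> nx m ny
    (\<lambda>f t u y. f = - (transpose_mat R *\<^sub>v u) \<and> t = s \<bullet> u \<and>
       transpose_mat Q *\<^sub>v u = 0\<^sub>v nu \<and> p \<bullet> u + 1 = 0 \<and>
       transpose_mat P *\<^sub>v u + y = 0\<^sub>v ny \<and> u \<in> dual_cone m K)"
proof (rule conic_constraint_cong)
  have "dual_cone m K \<in> \<K> m" using \<K> K by (simp add: cone_family_def)
  \<comment> \<open>Each clause is padded with zero coefficients to the common shape expected by the
    lemmas on single constraints.\<close>
  then show "conic_constraint \<K> nx m ny (\<lambda>f t u y.
      1\<^sub>m nx *\<^sub>v f + transpose_mat R *\<^sub>v u + 0\<^sub>m nx ny *\<^sub>v y = 0\<^sub>v nx \<and>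
      0\<^sub>v nx \<bullet> f + 1 * t + (- s) \<bullet> u + 0\<^sub>v ny \<bullet> y = 0 \<and>
      0\<^sub>m nu nx *\<^sub>v f + transpose_mat Q *\<^sub>v u + 0\<^sub>m nu ny *\<^sub>v y = 0\<^sub>v nu \<and>
      0\<^sub>v nx \<bullet> f + 0 * t + p \<bullet> u + 0\<^sub>v ny \<bullet> y = -1 \<and>
      0\<^sub>m ny nx *\<^sub>v f + transpose_mat P *\<^sub>v u + 1\<^sub>m ny *\<^sub>v y = 0\<^sub>v ny \<and> u \<in> dual_cone m K)"
    using assms
    by (intro conic_constraint_conj conic_constraint_vec_eq conic_constraint_eq conic_constraint_mem) auto
next
  fix f u y :: "real vec" and t :: real
  assume c: "f \<in> carrier_vec nx" "u \<in> carrier_vec m" "y \<in> carrier_vec ny"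
  have zero: "0\<^sub>m i j *\<^sub>v v = 0\<^sub>v i" if "v \<in> carrier_vec j" for i j and v :: "real vec"
    using that by (intro eq_vecI) auto
  have "f = - (transpose_mat R *\<^sub>v u) \<longleftrightarrow> f + transpose_mat R *\<^sub>v u = 0\<^sub>v nx"
    using c R by (auto simp: vec_eq_iff eq_neg_iff_add_eq_0)
  then show "(f = - (transpose_mat R *\<^sub>v u) \<and> t = s \<bullet> u \<and>
       transpose_mat Q *\<^sub>v u = 0\<^sub>v nu \<and> p \<bullet> u + 1 = 0 \<and>
       transpose_mat P *\<^sub>v u + y = 0\<^sub>v ny \<and> u \<in> dual_cone m K) \<longleftrightarrow>
     (1\<^sub>m nx *\<^sub>v f + transpose_mat R *\<^sub>v u + 0\<^sub>m nx ny *\<^sub>v y = 0\<^sub>v nx \<and>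
      0\<^sub>v nx \<bullet> f + 1 * t + (- s) \<bullet> u + 0\<^sub>v ny \<bullet> y = 0 \<and>
      0\<^sub>m nu nx *\<^sub>v f + transpose_mat Q *\<^sub>v u + 0\<^sub>m nu ny *\<^sub>v y = 0\<^sub>v nu \<and>
      0\<^sub>v nx \<bullet> f + 0 * t + p \<bullet> u + 0\<^sub>v ny \<bullet> y = -1 \<and>
      0\<^sub>m ny nx *\<^sub>v f + transpose_mat P *\<^sub>v u + 1\<^sub>m ny *\<^sub>v y = 0\<^sub>v ny \<and> u \<in> dual_cone m K)"
    using c P Q R s p zero[OF c(1)] zero[OF c(3)] by (auto simp: add_eq_0_iff)
qed

section \<open>Exchange of the convex and the concave argument, and the symmetry theorem\<close>

lemma continuous_convex_concave_swap:
  assumes "continuous_convex_concave nx ny X Y \<psi>"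
  shows "continuous_convex_concave ny nx Y X (\<lambda>y x. - \<psi> x y)"
proof -
  let ?X = "subtopology (vec_topology nx) X" and ?Y = "subtopology (vec_topology ny) Y"
  have "continuous_map (prod_topology ?X ?Y) euclideanreal (\<lambda>(x, y). \<psi> x y)"
    using assms by (simp add: continuous_convex_concave_def)
  moreover have "continuous_map (prod_topology ?Y ?X) (prod_topology ?X ?Y) (\<lambda>(y, x). (x, y))"
    by (rule homeomorphic_imp_continuous_map[OF homeomorphic_map_swap])
  ultimately have "continuous_map (prod_topology ?Y ?X) euclideanreal ((\<lambda>(x, y). \<psi> x y) \<circ> (\<lambda>(y, x). (x, y)))"
    by (rule continuous_map_compose[rotated])
  then have "continuous_map (prod_topology ?Y ?X) euclideanreal
      (\<lambda>z. - ((\<lambda>(x, y). \<psi> x y) \<circ> (\<lambda>(y, x). (x, y))) z)"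
    by (rule continuous_map_minus)
  also have "(\<lambda>z. - ((\<lambda>(x, y). \<psi> x y) \<circ> (\<lambda>(y, x). (x, y))) z) = (\<lambda>(y, x). - \<psi> x y)"
    by auto
  finally show ?thesis
    using assms by (simp add: continuous_convex_concave_def vec_concave_on_def)
qed

theorem mainTheorem3:
  fixes \<K> :: "nat \<Rightarrow> real vec set set"
    and nx ny nu m :: nat
    and X Y K :: "real vec set"
    and \<psi> :: "real vec \<Rightarrow> real vec \<Rightarrow> real"
    and P Q R :: "real mat" and p s :: "real vec"
  assumes "cone_family \<K>"
    and "X \<subseteq> carrier_vec nx" "X \<noteq> {}" "vec_convex X" "representable_set \<K> nx X"
    and "Y \<subseteq> carrier_vec ny" "Y \<noteq> {}" "vec_convex Y" "representable_set \<K> ny Y"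
    and "continuous_convex_concave nx ny X Y \<psi>"
    and "K \<in> \<K> m"
    and "P \<in> carrier_mat m ny" "p \<in> carrier_vec m" "Q \<in> carrier_mat m nu"
        "R \<in> carrier_mat m nx" "s \<in> carrier_vec m"
    and "is_representation \<K> nx ny nu X Y
           (\<lambda>f t u x. cone_le K (P *\<^sub>v f + t \<cdot>\<^sub>v p + Q *\<^sub>v u + R *\<^sub>v x) s) \<psi>"
    and "\<forall>x\<in>X. essentially_strictly_feasible m (ny + 1 + nu) K
           (block_matrix m P p Q) (s - R *\<^sub>v x)"
  shows "representable_function \<K> ny nx Y X (\<lambda>y x. - \<psi> x y) \<and>
    is_representation \<K> ny nx m Y X
      (\<lambda>f t u y. f = - (transpose_mat R *\<^sub>v u) \<and> t = s \<bullet> u \<and>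
         transpose_mat Q *\<^sub>v u = 0\<^sub>v nu \<and> p \<bullet> u + 1 = 0 \<and>
         transpose_mat P *\<^sub>v u + y = 0\<^sub>v ny \<and> u \<in> dual_cone m K)
      (\<lambda>y x. - \<psi> x y)"
proof -
  note P = assms(12) and p = assms(13) and Q = assms(14) and R = assms(15) and s = assms(16)
  let ?S = "\<lambda>f t u y. f = - (transpose_mat R *\<^sub>v u) \<and> t = s \<bullet> u \<and>
         transpose_mat Q *\<^sub>v u = 0\<^sub>v nu \<and> p \<bullet> u + 1 = 0 \<and>
         transpose_mat P *\<^sub>v u + y = 0\<^sub>v ny \<and> u \<in> dual_cone m K"
  have "ereal (- \<psi> x y) = Inf {ereal (f \<bullet> x + t) | f t u. f \<in> carrier_vec nx \<and> u \<in> carrier_vec m \<and> ?S f t u y}"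
    if x: "x \<in> X" and y: "y \<in> Y" for x y
  proof -
    have xc: "x \<in> carrier_vec nx" and yc: "y \<in> carrier_vec ny" using assms x y by auto
    define b where "b = s - R *\<^sub>v x"
    have b: "b \<in> carrier_vec m" using R s xc by (auto simp: b_def)
    have slack: "cone_le K (P *\<^sub>v f + t \<cdot>\<^sub>v p + Q *\<^sub>v u + R *\<^sub>v x) s \<longleftrightarrow>
        b - (P *\<^sub>v f + t \<cdot>\<^sub>v p + Q *\<^sub>v u) \<in> K"
      if "f \<in> carrier_vec ny" "u \<in> carrier_vec nu" for f t u
    proof -
      have "s - (P *\<^sub>v f + t \<cdot>\<^sub>v p + Q *\<^sub>v u + R *\<^sub>v x) = b - (P *\<^sub>v f + t \<cdot>\<^sub>v p + Q *\<^sub>v u)"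
        using P p Q R s xc that by (intro eq_vecI) (auto simp: b_def)
      then show ?thesis by (simp add: cone_le_def)
    qed
    have "ereal (\<psi> x y) = Inf {ereal (f \<bullet> y + t) | f t u. f \<in> carrier_vec ny \<and> u \<in> carrier_vec nu \<and>
        cone_le K (P *\<^sub>v f + t \<cdot>\<^sub>v p + Q *\<^sub>v u + R *\<^sub>v x) s}"
      using assms(17) x y by (simp add: is_representation_def)
    also have "{ereal (f \<bullet> y + t) | f t u. f \<in> carrier_vec ny \<and> u \<in> carrier_vec nu \<and>
        cone_le K (P *\<^sub>v f + t \<cdot>\<^sub>v p + Q *\<^sub>v u + R *\<^sub>v x) s} =
      {ereal (f \<bullet> y + t) | f t u. f \<in> carrier_vec ny \<and> u \<in> carrier_vec nu \<and>
        b - (P *\<^sub>v f + t \<cdot>\<^sub>v p + Q *\<^sub>v u) \<in> K}"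
      using slack by blast
    finally have psi: "ereal (\<psi> x y) = Inf \<dots>" .
    \<comment> \<open>Substituting the equations for the first two components moves \<open>x\<close>
      from the right-hand side of the primal into the dual objective.\<close>
    have dual_value: "(- (transpose_mat R *\<^sub>v u)) \<bullet> x + s \<bullet> u = b \<bullet> u" if "u \<in> carrier_vec m" for u
      using that R s xc transpose_vec_mult_scalar[OF R xc that] comm_scalar_prod[of "R *\<^sub>v x" m u]
      by (simp add: b_def minus_scalar_prod_distrib[of _ m])
    \<comment> \<open>The infimum equals the real number \<open>\<psi> x y\<close>, which is thus a
      valid bound \<open>v\<close> for strong duality.\<close>
    have "\<psi> x y \<le> f \<bullet> y + t" if "f \<in> carrier_vec ny" "u \<in> carrier_vec nu"
      "b - (P *\<^sub>v f + t \<cdot>\<^sub>v p + Q *\<^sub>v u) \<in> K" for f t u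
    proof -
      have "ereal (\<psi> x y) \<le> ereal (f \<bullet> y + t)" unfolding psi by (rule Inf_lower) (use that in blast)
      then show ?thesis by simp
    qed
    then obtain w where w: "w \<in> dual_cone m K" "transpose_mat Q *\<^sub>v w = 0\<^sub>v nu" "p \<bullet> w + 1 = 0"
      "transpose_mat P *\<^sub>v w + y = 0\<^sub>v ny" and bw: "b \<bullet> w \<le> - \<psi> x y"
      using representation_strong_duality[OF P p Q b yc, of K "\<psi> x y"] assms(18) x unfolding b_def by blast
    have wc: "w \<in> carrier_vec m" using w by (simp add: dual_cone_def)
    show ?thesis
    proof (rule antisym)
      \<comment> \<open>Weak duality bounds every primal value below by
        \<open>- (b \<bullet> u)\<close>, hence also their infimum
        \<open>\<psi> x y\<close>.\<close>
      have "ereal (- \<psi> x y) \<le> ereal (b \<bullet> u)"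
        if u: "u \<in> dual_cone m K" "transpose_mat Q *\<^sub>v u = 0\<^sub>v nu" "p \<bullet> u + 1 = 0"
          "transpose_mat P *\<^sub>v u + y = 0\<^sub>v ny" for u
      proof -
        have "ereal (- (b \<bullet> u)) \<le> ereal (\<psi> x y)"
          unfolding psi by (rule Inf_greatest) (use representation_weak_duality[OF P p Q b yc _ _ _ u] in auto)
        then show ?thesis by simp
      qed
      then show "ereal (- \<psi> x y) \<le> Inf {ereal (f \<bullet> x + t) | f t u.
          f \<in> carrier_vec nx \<and> u \<in> carrier_vec m \<and> ?S f t u y}"
        using dual_value by (intro Inf_greatest) auto
      \<comment> \<open>The multiplier \<open>w\<close> from strong duality, completed by the forced
        values of the other two components, is a dual solution that attains the infimum.\<close>
      have "ereal (b \<bullet> w) \<in> {ereal (f \<bullet> x + t) | f t u. f \<in> carrier_vec nx \<and> u \<in> carrier_vec m \<and> ?S f t u y}"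
        using w wc R dual_value[OF wc]
        by (intro CollectI exI[of _ "- (transpose_mat R *\<^sub>v w)"] exI[of _ "s \<bullet> w"] exI[of _ w]) auto
      then have "Inf {ereal (f \<bullet> x + t) | f t u. f \<in> carrier_vec nx \<and> u \<in> carrier_vec m \<and> ?S f t u y} \<le> ereal (b \<bullet> w)"
        by (rule Inf_lower)
      also have "\<dots> \<le> ereal (- \<psi> x y)" using bw by simp
      finally show "Inf {ereal (f \<bullet> x + t) | f t u.
          f \<in> carrier_vec nx \<and> u \<in> carrier_vec m \<and> ?S f t u y} \<le> ereal (- \<psi> x y)" .
    qed
  qed
  then have "is_representation \<K> ny nx m Y X ?S (\<lambda>y x. - \<psi> x y)"
    unfolding is_representation_def
    using conic_constraint_dual_system[OF assms(1) assms(11) P p Q R s] by blast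
  then show ?thesis
    using continuous_convex_concave_swap[OF assms(10)] unfolding representable_function_def by blast
qed

end
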